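(* Let $\mathcal C$ be an LDPC code with column weight $\gamma\ge 3$ (every v-node of its Tanner graph has degree $\gamma$) whose Tanner graph has no $4$-cycles and no $8$-cycle with a chord. Then the minimum distance of $\mathcal C$ satisfies $d_{\min}\ge 2\gamma$.
   Context: An LDPC code is the null space over $\mathbb F_2$ of a binary parity-check matrix $H$; its Tanner graph is the simple bipartite graph with variable-nodes (v-nodes, one per column of $H$) and check-nodes (c-nodes, one per row), adjacent iff the corresponding entry of $H$ is $1$. $d_{\min}$ is the minimum Hamming weight of a nonzero codeword. A cycle $C$ of the Tanner graph is a cycle with a chord if some c-node outside $C$ is adjacent to two distinct v-nodes of $C$, or some edge not in $C$ joins a v-node of $C$ to a c-node of $C$; otherwise it is chordless. *)

theory Defs
  imports
    "HOL-Library.Z2"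
    "HOL-Library.Extended_Nat"
    "Jordan_Normal_Form.Matrix_Kernel"
    "Graph_Theory.Graph_Theory"
begin

text \<open>The type \<^typ>\<open>bit\<close> is the two-element field.\<close>

definition ldpc_code :: "bit mat \<Rightarrow> bit vec set" where
  "ldpc_code H = mat_kernel H"

definition hamming_weight :: "'a::zero vec \<Rightarrow> nat" where
  "hamming_weight x = card {j. j < dim_vec x \<and> x $ j \<noteq> 0}"

text \<open>The infimum of the empty set is \<open>\<infinity>\<close>, so a code without nonzero codewords has minimum
  distance \<open>\<infinity>\<close>; otherwise the infimum is attained.\<close>

definition min_distance :: "'a::zero vec set \<Rightarrow> enat" where
  "min_distance \<C> = (INF x \<in> {x \<in> \<C>. x \<noteq> 0\<^sub>v (dim_vec x)}. enat (hamming_weight x))"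

datatype tanner_node = V_Node nat | C_Node nat

text \<open>An undirected simple graph is represented by a symmetric loop-free pair digraph, as
  in the locale \<^locale>\<open>pair_graph\<close>: an edge is the pair of its two opposite arcs.\<close>

definition tanner_graph :: "bit mat \<Rightarrow> tanner_node pair_pre_digraph" where
  "tanner_graph H = \<lparr>
     pverts = V_Node ` {..<dim_col H} \<union> C_Node ` {..<dim_row H},
     parcs = {(V_Node j, C_Node i) | i j. i < dim_row H \<and> j < dim_col H \<and> H $$ (i, j) = 1}
           \<union> {(C_Node i, V_Node j) | i j. i < dim_row H \<and> j < dim_col H \<and> H $$ (i, j) = 1} \<rparr>"

lemma pair_graph_tanner_graph: "pair_graph (tanner_graph H)"
proof
  have "parcs (tanner_graph H) \<subseteq> pverts (tanner_graph H) \<times> pverts (tanner_graph H)"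
    by (auto simp: tanner_graph_def)
  moreover show "finite (pverts (tanner_graph H))"
    by (simp add: tanner_graph_def)
  ultimately show "finite (parcs (tanner_graph H))"
    by (meson finite_SigmaI finite_subset)
  show "symmetric (with_proj (tanner_graph H))"
    by (auto simp: symmetric_def tanner_graph_def intro!: symI)
qed (auto simp: tanner_graph_def)

text \<open>The out-degree of a node is its degree in the undirected graph, because each incident
  edge contributes exactly one outgoing arc.\<close>

definition has_column_weight :: "bit mat \<Rightarrow> nat \<Rightarrow> bool" where
  "has_column_weight H \<gamma> \<longleftrightarrow>
     (\<forall>j < dim_col H. out_degree (with_proj (tanner_graph H)) (V_Node j) = \<gamma>)"

text \<open>A directed cycle of \<^const>\<open>pre_digraph.cycle\<close> may be a single edge traversed back and
  forth, but only for length 2; for larger lengths its underlying edges form an undirected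
  cycle with the same number of edges.\<close>

definition is_cycle_of_length :: "tanner_node pair_pre_digraph \<Rightarrow> nat \<Rightarrow>
    (tanner_node \<times> tanner_node) list \<Rightarrow> bool" where
  "is_cycle_of_length G k p \<longleftrightarrow> k \<ge> 3 \<and> pre_digraph.cycle (with_proj G) p \<and> length p = k"

text \<open>The tails of the arcs of a closed walk are all of its nodes.\<close>

definition cycle_nodes :: "(tanner_node \<times> tanner_node) list \<Rightarrow> tanner_node set" where
  "cycle_nodes p = fst ` set p"

definition has_chord :: "tanner_node pair_pre_digraph \<Rightarrow>
    (tanner_node \<times> tanner_node) list \<Rightarrow> bool" where
  "has_chord G p \<longleftrightarrow>
     (\<exists>i j j'. C_Node i \<notin> cycle_nodes p \<and>
        V_Node j \<in> cycle_nodes p \<and> V_Node j' \<in> cycle_nodes p \<and> j \<noteq> j' \<and>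
        (V_Node j, C_Node i) \<in> parcs G \<and> (V_Node j', C_Node i) \<in> parcs G) \<or>
     (\<exists>i j. V_Node j \<in> cycle_nodes p \<and> C_Node i \<in> cycle_nodes p \<and>
        (V_Node j, C_Node i) \<in> parcs G \<and>
        (V_Node j, C_Node i) \<notin> set p \<and> (C_Node i, V_Node j) \<notin> set p)"

end

theory Submission
  imports Defs
begin

text \<open>Join two v-nodes when they share a c-node. Without 4-cycles the c-node is unique, and every
  c-node adjacent to the support of a codeword is adjacent to at least two of its v-nodes, so in the
  support each v-node has neighbours through each of its \<open>\<gamma>\<close> c-nodes. Fix two adjacent
  v-nodes \<open>u\<close>, \<open>v\<close> of the support. If they have no common neighbour off the c-node joining
  them, then they and their neighbours make \<open>2 + 2 (\<gamma> - 1)\<close> v-nodes. Otherwise they lie in a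
  triangle; two triangles on one edge form an 8-cycle with a chord, hence the neighbours of the
  three corners off the triangle are distinct, which gives
  \<open>3 + 3 (\<gamma> - 2) \<ge> 2 \<gamma>\<close> v-nodes.\<close>

lemma card_ge_two_gamma:
  fixes I :: "'v \<Rightarrow> 'c \<Rightarrow> bool"
  assumes "finite S" and "S \<noteq> {}" and gamma: "\<gamma> \<ge> 3"
    and card: "\<And>u. u \<in> S \<Longrightarrow> card {c. I u c} = \<gamma>"
    and other: "\<And>u c. u \<in> S \<Longrightarrow> I u c \<Longrightarrow> \<exists>v\<in>S. v \<noteq> u \<and> I v c"
    and no4: "\<And>u v c d. u \<in> S \<Longrightarrow> v \<in> S \<Longrightarrow> u \<noteq> v \<Longrightarrow>
      I u c \<Longrightarrow> I v c \<Longrightarrow> I u d \<Longrightarrow> I v d \<Longrightarrow> c = d"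
    and no8: "\<And>u x v w c d e f g. {u, x, v, w} \<subseteq> S \<Longrightarrow> distinct [u, x, v, w] \<Longrightarrow>
      distinct [f, g, e, d, c] \<Longrightarrow> I u f \<Longrightarrow> I x f \<Longrightarrow> I x g \<Longrightarrow> I v g \<Longrightarrow>
      I v e \<Longrightarrow> I w e \<Longrightarrow> I w d \<Longrightarrow> I u d \<Longrightarrow> I u c \<Longrightarrow> I v c \<Longrightarrow> False"
  shows "2 * \<gamma> \<le> card S"
proof -
  obtain n where n: "\<And>u c. u \<in> S \<Longrightarrow> I u c \<Longrightarrow> n u c \<in> S \<and> n u c \<noteq> u \<and> I (n u c) c"
    using other by metis
  \<comment> \<open>Since \<open>n u c\<close> picks one other v-node of \<open>S\<close> at
    \<open>c\<close>, \<open>A u F\<close> holds one chosen neighbour of \<open>u\<close> for each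
    c-node of \<open>u\<close> outside \<open>F\<close>, not all neighbours; this makes its size
    exact.\<close>
  define A where "A u F = n u ` ({c. I u c} - F)" for u F
  have AE: "\<exists>c. I u c \<and> I x c \<and> c \<notin> F \<and> x \<noteq> u" if "x \<in> A u F" "u \<in> S" for x u F
    using that n by (auto simp: A_def)
  have fin: "finite {c. I u c}" if "u \<in> S" for u
    using card[OF that] gamma by (intro card_ge_0_finite) simp
  have AS: "A u F \<subseteq> S" if "u \<in> S" for u F
    using that n by (auto simp: A_def)
  have cardA: "card (A u F) = \<gamma> - card F" if "u \<in> S" "F \<subseteq> {c. I u c}" for u F
  proof -
    \<comment> \<open>A neighbour chosen through two c-nodes would close a 4-cycle with
      \<open>u\<close>.\<close>
    have "inj_on (n u) {c. I u c}"
      using n no4 that(1) by (intro inj_onI) (metis mem_Collect_eq)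
    then have "card (A u F) = card ({c. I u c} - F)"
      unfolding A_def by (intro card_image) (auto intro: inj_on_subset)
    then show ?thesis
      using that card fin by (metis card_Diff_subset finite_subset)
  qed
  have finA: "finite (A u F)" if "u \<in> S" for u F
    using AS[OF that] assms(1) finite_subset by blast
  obtain u where u: "u \<in> S" using assms(2) by blast
  then have "card {c. I u c} \<noteq> 0" using card gamma by simp
  then obtain c where uc: "I u c" by (metis card.empty empty_Collect_eq)
  define v where "v = n u c"
  have v: "v \<in> S" "v \<noteq> u" "I v c" using n[OF u uc] by (auto simp: v_def)
  show ?thesis
  proof (cases "A u {c} \<inter> A v {c} = {}")
    case True
    \<comment> \<open>The only c-node shared by \<open>u\<close> and \<open>v\<close> is
      \<open>c\<close>, which is left out of both sets.\<close>
    have "u \<notin> A u {c}" "v \<notin> A v {c}" "v \<notin> A u {c}" "u \<notin> A v {c}"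
      using AE[OF _ u] AE[OF _ v(1)] no4[OF u v(1)] uc v by blast+
    then have "card (insert u (insert v (A u {c} \<union> A v {c}))) = 2 + 2 * (\<gamma> - 1)"
      using True u v uc finA by (simp add: card_Un_disjoint cardA)
    moreover have "insert u (insert v (A u {c} \<union> A v {c})) \<subseteq> S"
      using AS u v by auto
    ultimately have "2 + 2 * (\<gamma> - 1) \<le> card S"
      using assms(1) by (metis card_mono)
    then show ?thesis by simp
  next
    case False
    \<comment> \<open>A triangle with corners \<open>u\<close>, \<open>v\<close>, \<open>w\<close>:
      \<open>c\<close> joins \<open>u\<close> and \<open>v\<close>, \<open>d\<close> joins
      \<open>u\<close> and \<open>w\<close>, \<open>e\<close> joins \<open>v\<close> and
      \<open>w\<close>.\<close>
    then obtain w where wu: "w \<in> A u {c}" and wv: "w \<in> A v {c}" by blast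
    have w: "w \<in> S" using wu AS u by blast
    obtain d where d: "I u d" "I w d" "d \<noteq> c" "w \<noteq> u" using AE[OF wu u] by blast
    obtain e where e: "I v e" "I w e" "e \<noteq> c" "w \<noteq> v" using AE[OF wv v(1)] by blast
    have de: "d \<noteq> e" using no4[OF u v(1)] v d e uc by metis
    have corner: "w \<notin> A u F" if "u \<in> S" "w \<in> S" "I u d" "I w d" "d \<in> F" for u w d F
      using AE[of w u F] no4[of u w] that by blast
    have self: "u \<notin> A u F" if "u \<in> S" for u F
      using AE that by blast
    \<comment> \<open>Arbitrary corners, so that it applies to each side of the triangle. A common
      element \<open>x\<close> would be the tip of a second triangle on the side from
      \<open>u\<close> to \<open>v\<close>.\<close>
    have disj: "A u F \<inter> A v G = {}"
      if "{u, v, w} \<subseteq> S" "distinct [u, v, w]" "distinct [c, d, e]"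
        "I u c" "I v c" "I u d" "I w d" "I v e" "I w e" "{c, d} \<subseteq> F" "{c, e} \<subseteq> G"
      for u v w c d e F G
    proof (rule ccontr)
      assume "A u F \<inter> A v G \<noteq> {}"
      then obtain x where x: "x \<in> A u F" "x \<in> A v G" by blast
      have uvS: "u \<in> S" "v \<in> S" using that by auto
      then have xS: "x \<in> S" using x AS by blast
      have xw: "x \<noteq> w" using corner[of u w d F] that x by auto
      obtain f where f: "I u f" "I x f" "f \<notin> F" "x \<noteq> u" using AE[OF x(1) uvS(1)] by blast
      obtain g where g: "I v g" "I x g" "g \<notin> G" "x \<noteq> v" using AE[OF x(2) uvS(2)] by blast
      have uv: "i = c" if "I u i" "I v i" for i
        using no4[OF uvS] that \<open>distinct [u, v, w]\<close> \<open>I u c\<close> \<open>I v c\<close> by auto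
      \<comment> \<open>A c-node adjacent to both \<open>u\<close> and \<open>v\<close> must be
        \<open>c\<close>, and \<open>c\<close> is none of \<open>d\<close>, \<open>e\<close>,
        \<open>f\<close>, \<open>g\<close>.\<close>
      have "f \<noteq> g" "f \<noteq> e" "g \<noteq> d"
        using uv f g that by blast+
      then have "distinct [f, g, e, d, c]" using that f g by auto
      \<comment> \<open>The 8-cycle is \<open>u f x g v e w d\<close>; the c-node \<open>c\<close>
        lies off it and is adjacent to \<open>u\<close> and \<open>v\<close>, which gives the
        chord.\<close>
      then show False
        using no8[of u x v w f g e d c] that f g xS xw by auto
    qed
    have "A u {c, d} \<inter> A v {c, e} = {}" "A u {c, d} \<inter> A w {d, e} = {}"
      "A v {c, e} \<inter> A w {d, e} = {}"
      using disj[of u v w c d e] disj[of u w v d c e] disj[of v w u e c d] u v w uc d e de by auto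
    moreover have "w \<notin> A u {c, d}" "v \<notin> A u {c, d}" "u \<notin> A u {c, d}"
      "w \<notin> A v {c, e}" "v \<notin> A v {c, e}" "u \<notin> A v {c, e}"
      "w \<notin> A w {d, e}" "v \<notin> A w {d, e}" "u \<notin> A w {d, e}"
      using corner self u v w uc d e by (metis insertI1 insertI2)+
    ultimately have "card (insert u (insert v (insert w (A u {c, d} \<union> (A v {c, e} \<union> A w {d, e})))))
        = 3 + 3 * (\<gamma> - 2)"
      using u v w uc d e de finA by (simp add: card_Un_disjoint cardA Int_Un_distrib)
    moreover have "insert u (insert v (insert w (A u {c, d} \<union> (A v {c, e} \<union> A w {d, e})))) \<subseteq> S"
      using AS u v w by auto
    ultimately have "3 + 3 * (\<gamma> - 2) \<le> card S"
      using assms(1) by (metis card_mono)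
    \<comment> \<open>The bound equals \<open>3 * \<gamma> - 3\<close>, which reaches
      \<open>2 * \<gamma>\<close> because \<gamma> \<ge> 3.\<close>
    then show ?thesis using gamma by simp
  qed
qed

text \<open>The relation put for \<open>I\<close> in \<open>card_ge_two_gamma\<close>. The column
  comes first and the row second, the reverse of the matrix index.\<close>

definition incident :: "bit mat \<Rightarrow> nat \<Rightarrow> nat \<Rightarrow> bool" where
  "incident H j i \<longleftrightarrow> (V_Node j, C_Node i) \<in> parcs (tanner_graph H)"

lemma incident_iff: "incident H j i \<longleftrightarrow> i < dim_row H \<and> j < dim_col H \<and> H $$ (i, j) = 1"
  by (auto simp: incident_def tanner_graph_def)

lemma out_degree_V_Node:
  "out_degree (with_proj (tanner_graph H)) (V_Node j) = card {i. incident H j i}"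
proof -
  have "out_arcs (with_proj (tanner_graph H)) (V_Node j)
      = (\<lambda>i. (V_Node j, C_Node i)) ` {i. incident H j i}"
    by (auto simp: out_arcs_def incident_iff tanner_graph_def)
  then show ?thesis
    by (simp add: out_degree_def card_image inj_on_def)
qed

text \<open>If \<open>j\<close> were the only support position in row \<open>i\<close>, the parity
  check of that row would reduce to the single nonzero term at \<open>j\<close>.\<close>

lemma codeword_check_other:
  assumes "x \<in> ldpc_code H" and "x $ j \<noteq> 0" and "incident H j i"
  shows "\<exists>k. k < dim_vec x \<and> x $ k \<noteq> 0 \<and> k \<noteq> j \<and> incident H k i"
proof (rule ccontr)
  assume none: "\<not> ?thesis"
  have x: "x \<in> carrier_vec (dim_col H)" "H *\<^sub>v x = 0\<^sub>v (dim_row H)"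
    using assms(1) by (auto simp: ldpc_code_def mat_kernel_def)
  have i: "i < dim_row H" and j: "j < dim_col H" and Hij: "H $$ (i, j) = 1"
    using assms(3) by (auto simp: incident_iff)
  have "(\<Sum>k<dim_col H. H $$ (i, k) * x $ k) = (H *\<^sub>v x) $ i"
    using x(1) i by (auto simp: scalar_prod_def lessThan_atLeast0)
  also have "\<dots> = 0" using x(2) i by simp
  finally have "(\<Sum>k<dim_col H. H $$ (i, k) * x $ k) = 0" .
  moreover have "(\<Sum>k<dim_col H. H $$ (i, k) * x $ k) = (\<Sum>k\<in>{j}. H $$ (i, k) * x $ k)"
    using none x(1) i j
    by (intro sum.mono_neutral_right) (auto simp: incident_iff)
  ultimately show False using Hij assms(2) by simp
qed

lemma tanner_arcs_incident:
  "(V_Node j, C_Node i) \<in> parcs (tanner_graph H) \<longleftrightarrow> incident H j i"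
  "(C_Node i, V_Node j) \<in> parcs (tanner_graph H) \<longleftrightarrow> incident H j i"
  by (auto simp: incident_iff tanner_graph_def)

lemma incident_verts:
  assumes "incident H j i"
  shows "V_Node j \<in> pverts (tanner_graph H)" "C_Node i \<in> pverts (tanner_graph H)"
  using assms by (auto simp: incident_iff tanner_graph_def)

text \<open>Reduces the claim that an explicit list of arcs is a cycle to incidences and
  distinctness of nodes.\<close>

lemmas cycle_unfold = is_cycle_of_length_def pre_digraph.cycle_def pre_digraph.awalk_def
  pre_digraph.cas.simps pre_digraph.awalk_verts.simps tanner_arcs_incident incident_verts

lemma four_cycle:
  assumes "u \<noteq> v" "c \<noteq> d" "incident H u c" "incident H v c" "incident H v d" "incident H u d"
  shows "is_cycle_of_length (tanner_graph H) 4
    [(V_Node u, C_Node c), (C_Node c, V_Node v), (V_Node v, C_Node d), (C_Node d, V_Node u)]"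
  using assms by (auto simp: cycle_unfold)

lemma eight_cycle:
  assumes "distinct [u, x, v, w]" "distinct [f, g, e, d]"
    "incident H u f" "incident H x f" "incident H x g" "incident H v g"
    "incident H v e" "incident H w e" "incident H w d" "incident H u d"
  shows "is_cycle_of_length (tanner_graph H) 8
    [(V_Node u, C_Node f), (C_Node f, V_Node x), (V_Node x, C_Node g), (C_Node g, V_Node v),
     (V_Node v, C_Node e), (C_Node e, V_Node w), (V_Node w, C_Node d), (C_Node d, V_Node u)]"
  using assms by (auto simp: cycle_unfold)

theorem theorem4:
  fixes H :: "bit mat" and \<gamma> :: nat
  assumes "\<gamma> \<ge> 3"
    and "has_column_weight H \<gamma>"
    and "\<not> (\<exists>p. is_cycle_of_length (tanner_graph H) 4 p)"
    and "\<not> (\<exists>p. is_cycle_of_length (tanner_graph H) 8 p \<and> has_chord (tanner_graph H) p)"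
  shows "min_distance (ldpc_code H) \<ge> enat (2 * \<gamma>)"
proof -
  have "2 * \<gamma> \<le> hamming_weight x" if x: "x \<in> ldpc_code H" "x \<noteq> 0\<^sub>v (dim_vec x)" for x
    unfolding hamming_weight_def
  \<comment> \<open>The set \<open>S\<close> is the support of the codeword
    \<open>x\<close>.\<close>
  proof (rule card_ge_two_gamma[where I = "incident H"])
    show "{j. j < dim_vec x \<and> x $ j \<noteq> 0} \<noteq> {}"
    proof
      assume "{j. j < dim_vec x \<and> x $ j \<noteq> 0} = {}"
      then have "x = 0\<^sub>v (dim_vec x)" by (intro eq_vecI) auto
      with x(2) show False by contradiction
    qed
  next
    fix j assume "j \<in> {j. j < dim_vec x \<and> x $ j \<noteq> 0}"
    moreover have "dim_vec x = dim_col H"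
      using x(1) by (auto simp: ldpc_code_def mat_kernel_def)
    ultimately show "card {i. incident H j i} = \<gamma>"
      using assms(2) by (simp add: has_column_weight_def out_degree_V_Node)
  next
    fix j i assume "j \<in> {j. j < dim_vec x \<and> x $ j \<noteq> 0}" "incident H j i"
    then show "\<exists>k\<in>{j. j < dim_vec x \<and> x $ j \<noteq> 0}. k \<noteq> j \<and> incident H k i"
      using codeword_check_other[OF x(1)] by auto
  next
    fix u v c d
    assume "u \<noteq> v" "incident H u c" "incident H v c" "incident H u d" "incident H v d"
    then show "c = d" using four_cycle[of u v c d H] assms(3) by blast
  next
    fix u x v w c d e f g
    assume *: "distinct [u, x, v, w]" "distinct [f, g, e, d, c]"
      "incident H u f" "incident H x f" "incident H x g" "incident H v g"
      "incident H v e" "incident H w e" "incident H w d" "incident H u d"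
      and uv: "incident H u c" "incident H v c"
    let ?p = "[(V_Node u, C_Node f), (C_Node f, V_Node x), (V_Node x, C_Node g), (C_Node g, V_Node v),
      (V_Node v, C_Node e), (C_Node e, V_Node w), (V_Node w, C_Node d), (C_Node d, V_Node u)]"
    have "is_cycle_of_length (tanner_graph H) 8 ?p"
      using * by (intro eight_cycle) auto
    moreover have "has_chord (tanner_graph H) ?p"
      unfolding has_chord_def
    \<comment> \<open>The chord is of the first kind: a c-node off the cycle with two neighbours on
      it.\<close>
    proof (intro disjI1 exI conjI)
      show "C_Node c \<notin> cycle_nodes ?p" "V_Node u \<in> cycle_nodes ?p"
        "V_Node v \<in> cycle_nodes ?p" "u \<noteq> v"
        using * by (auto simp: cycle_nodes_def)
    qed (use uv in \<open>auto simp: tanner_arcs_incident\<close>)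
    ultimately show False using assms(4) by blast
  qed (use assms(1) in auto)
  \<comment> \<open>An infimum is bounded below once every nonzero codeword is; with no such
    codeword it is \<infinity>.\<close>
  then show ?thesis
    by (auto simp: min_distance_def intro!: INF_greatest)
qed

end
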